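(* Let $\mathcal{C}$ be a semiabelian category and $A$ an object of $\mathcal{C}$. Let $(A'',i'')$ be a strict subobject of $A$ and $(A',i)$ a strict subobject of $A''$; regard $A'$ as the strict subobject $(A',i''i)$ of $A$. Let $v:A/A'\to A/A''$ be the unique strict surjective morphism in $\mathcal{C}$ such that $j''=vj'$, where $j':A\to A/A'$ and $j'':A\to A/A''$ are the cokernel morphisms of $i''i$ and $i''$, respectively, and let $(\mathrm{Ker}(v),\ell)$ be the kernel of $v$. Then there exists a sequence $$A''/A'\longrightarrow \mathrm{Ker}(v)\xrightarrow{\ \ell\ }A/A'\xrightarrow{\ v\ }A/A''$$ of morphisms in $\mathcal{C}$ in which the morphism on the left is bijective. Moreover, $(A/A')/\mathrm{Ker}(v)$ and $A/A''$ are isomorphic.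
   Context: A morphism is called injective if it is a monomorphism, surjective if it is an epimorphism, and bijective if it is both (a bijective morphism need not be an isomorphism). A category $\mathcal{C}$ is preadditive if each $\mathrm{Mor}_{\mathcal{C}}(A,B)$ is an abelian group (with identity element $0_{AB}$), composition is $\mathbb{Z}$-bilinear, and there is an object $Z$ with $1_Z=0_{ZZ}$ (a zero object). Kernels $(\mathrm{Ker}(u),i)$ and cokernels $(\mathrm{Coker}(u),j)$ of a morphism $u$ have their usual meaning. If every morphism has a kernel and a cokernel, then for $u:A\to B$ the image $\mathrm{Im}(u)$ is the kernel of the cokernel morphism $B\to\mathrm{Coker}(u)$, with canonical morphism $\mathrm{Im}(u)\to B$, and the coimage $\mathrm{Coim}(u)$ is the cokernel of the kernel morphism $\mathrm{Ker}(u)\to A$, with canonical morphism $A\to\mathrm{Coim}(u)$; there is a unique $\overline{u}:\mathrm{Coim}(u)\to\mathrm{Im}(u)$ such that $u$ equals the composite $A\to\mathrm{Coim}(u)\xrightarrow{\overline{u}}\mathrm{Im}(u)\to B$. $\mathcal{C}$ is semiabelian (in the sense of Palamodov) if it is preadditive, every morphism has a kernel and a cokernel, finite products exist, and for every morphism $u$ the morphism $\overline{u}$ is bijective. A morphism $u$ is strict if $\overline{u}$ is an isomorphism. A subobject of $A$ is a pair $(A',i')$ with $i':A'\to A$ injective; it is a strict subobject if $i'$ is strict. In a semiabelian category the composite of two strict injective morphisms is strict, and kernel morphisms are strict. For a strict subobject $(X,k)$ of $Y$, $Y/X$ denotes $\mathrm{Coker}(k)$. Thus $A''/A'=\mathrm{Coker}(i)$,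 $A/A'=\mathrm{Coker}(i''i)$, $A/A''=\mathrm{Coker}(i'')$ and $(A/A')/\mathrm{Ker}(v)=\mathrm{Coker}(\ell)$. *)

theory Defs
  imports "HOL-Algebra.Group"
begin

text \<open>
  Categories with a partial addition on arrows. Objects and arrows form sets in arbitrary
  types; every arrow carries its domain and codomain, so that the sets \<open>Hom C A B\<close> are disjoint.
  The values of the operations are unconstrained outside the sets \<open>Obj\<close>, \<open>Mor\<close> and \<open>Hom\<close>.
\<close>

record ('o, 'm) precategory =
  Obj :: "'o set"
  Mor :: "'m set"
  Src :: "'m \<Rightarrow> 'o"
  Tgt :: "'m \<Rightarrow> 'o"
  Ident :: "'o \<Rightarrow> 'm"
  Comp :: "'m \<Rightarrow> 'm \<Rightarrow> 'm"  (infixl \<open>\<cdot>\<index>\<close> 70)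
  Plus :: "'m \<Rightarrow> 'm \<Rightarrow> 'm"
  Zero :: "'o \<Rightarrow> 'o \<Rightarrow> 'm"

definition Hom :: "('o, 'm) precategory \<Rightarrow> 'o \<Rightarrow> 'o \<Rightarrow> 'm set" where
  "Hom C A B = {f \<in> Mor C. Src C f = A \<and> Tgt C f = B}"

definition Hom_group :: "('o, 'm) precategory \<Rightarrow> 'o \<Rightarrow> 'o \<Rightarrow> 'm monoid" where
  "Hom_group C A B = \<lparr>carrier = Hom C A B, monoid.mult = Plus C, one = Zero C A B\<rparr>"

locale category =
  fixes C :: "('o, 'm) precategory" (structure)
  assumes Src_Obj: "f \<in> Mor C \<Longrightarrow> Src C f \<in> Obj C"
    and Tgt_Obj: "f \<in> Mor C \<Longrightarrow> Tgt C f \<in> Obj C"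
    and Ident_Hom: "A \<in> Obj C \<Longrightarrow> Ident C A \<in> Hom C A A"
    and Comp_Hom: "\<lbrakk>f \<in> Hom C A B; g \<in> Hom C B D\<rbrakk> \<Longrightarrow> g \<cdot> f \<in> Hom C A D"
    and Comp_Ident: "f \<in> Hom C A B \<Longrightarrow> f \<cdot> Ident C A = f"
    and Ident_Comp: "f \<in> Hom C A B \<Longrightarrow> Ident C B \<cdot> f = f"
    and Comp_assoc:
      "\<lbrakk>f \<in> Hom C A B; g \<in> Hom C B D; h \<in> Hom C D E\<rbrakk> \<Longrightarrow> h \<cdot> (g \<cdot> f) = (h \<cdot> g) \<cdot> f"

definition injective :: "('o, 'm) precategory \<Rightarrow> 'm \<Rightarrow> bool" where
  "injective C f \<longleftrightarrow> f \<in> Mor C \<and>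
     (\<forall>T\<in>Obj C. \<forall>g\<in>Hom C T (Src C f). \<forall>h\<in>Hom C T (Src C f).
        f \<cdot>\<^bsub>C\<^esub> g = f \<cdot>\<^bsub>C\<^esub> h \<longrightarrow> g = h)"

definition surjective :: "('o, 'm) precategory \<Rightarrow> 'm \<Rightarrow> bool" where
  "surjective C f \<longleftrightarrow> f \<in> Mor C \<and>
     (\<forall>T\<in>Obj C. \<forall>g\<in>Hom C (Tgt C f) T. \<forall>h\<in>Hom C (Tgt C f) T.
        g \<cdot>\<^bsub>C\<^esub> f = h \<cdot>\<^bsub>C\<^esub> f \<longrightarrow> g = h)"

definition bijective :: "('o, 'm) precategory \<Rightarrow> 'm \<Rightarrow> bool" where
  "bijective C f \<longleftrightarrow> injective C f \<and> surjective C f"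

definition isomorphism :: "('o, 'm) precategory \<Rightarrow> 'm \<Rightarrow> bool" where
  "isomorphism C f \<longleftrightarrow> f \<in> Mor C \<and>
     (\<exists>g\<in>Hom C (Tgt C f) (Src C f).
        g \<cdot>\<^bsub>C\<^esub> f = Ident C (Src C f) \<and> f \<cdot>\<^bsub>C\<^esub> g = Ident C (Tgt C f))"

definition isomorphic :: "('o, 'm) precategory \<Rightarrow> 'o \<Rightarrow> 'o \<Rightarrow> bool" where
  "isomorphic C A B \<longleftrightarrow> (\<exists>f\<in>Hom C A B. isomorphism C f)"

definition is_product ::
    "('o, 'm) precategory \<Rightarrow> nat \<Rightarrow> (nat \<Rightarrow> 'o) \<Rightarrow> 'o \<Rightarrow> (nat \<Rightarrow> 'm) \<Rightarrow> bool" where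
  "is_product C n X P p \<longleftrightarrow> P \<in> Obj C \<and> (\<forall>k<n. p k \<in> Hom C P (X k)) \<and>
     (\<forall>T\<in>Obj C. \<forall>f. (\<forall>k<n. f k \<in> Hom C T (X k)) \<longrightarrow>
        (\<exists>!g. g \<in> Hom C T P \<and> (\<forall>k<n. p k \<cdot>\<^bsub>C\<^esub> g = f k)))"

locale preadditive_category = category +
  assumes comm_group_Hom: "\<lbrakk>A \<in> Obj C; B \<in> Obj C\<rbrakk> \<Longrightarrow> comm_group (Hom_group C A B)"
    and Comp_Plus: "\<lbrakk>f \<in> Hom C A B; f' \<in> Hom C A B; g \<in> Hom C B D\<rbrakk>
      \<Longrightarrow> g \<cdot> Plus C f f' = Plus C (g \<cdot> f) (g \<cdot> f')"
    and Plus_Comp: "\<lbrakk>f \<in> Hom C A B; g \<in> Hom C B D; g' \<in> Hom C B D\<rbrakk>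
      \<Longrightarrow> Plus C g g' \<cdot> f = Plus C (g \<cdot> f) (g' \<cdot> f)"
    and zero_object: "\<exists>Z\<in>Obj C. Ident C Z = Zero C Z Z"

text \<open>
  Kernels, cokernels, images and coimages are determined only up to isomorphism and are
  therefore rendered as relations: \<open>is_kernel C u K i\<close> says that \<open>(K, i)\<close> is a kernel of \<open>u\<close>.
\<close>

definition is_kernel :: "('o, 'm) precategory \<Rightarrow> 'm \<Rightarrow> 'o \<Rightarrow> 'm \<Rightarrow> bool" where
  "is_kernel C u K i \<longleftrightarrow> u \<in> Mor C \<and> K \<in> Obj C \<and> i \<in> Hom C K (Src C u) \<and>
     u \<cdot>\<^bsub>C\<^esub> i = Zero C K (Tgt C u) \<and>
     (\<forall>T\<in>Obj C. \<forall>f\<in>Hom C T (Src C u). u \<cdot>\<^bsub>C\<^esub> f = Zero C T (Tgt C u) \<longrightarrow>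
        (\<exists>!g. g \<in> Hom C T K \<and> i \<cdot>\<^bsub>C\<^esub> g = f))"

definition is_cokernel :: "('o, 'm) precategory \<Rightarrow> 'm \<Rightarrow> 'o \<Rightarrow> 'm \<Rightarrow> bool" where
  "is_cokernel C u Q j \<longleftrightarrow> u \<in> Mor C \<and> Q \<in> Obj C \<and> j \<in> Hom C (Tgt C u) Q \<and>
     j \<cdot>\<^bsub>C\<^esub> u = Zero C (Src C u) Q \<and>
     (\<forall>T\<in>Obj C. \<forall>f\<in>Hom C (Tgt C u) T. f \<cdot>\<^bsub>C\<^esub> u = Zero C (Src C u) T \<longrightarrow>
        (\<exists>!g. g \<in> Hom C Q T \<and> g \<cdot>\<^bsub>C\<^esub> j = f))"

definition is_image :: "('o, 'm) precategory \<Rightarrow> 'm \<Rightarrow> 'o \<Rightarrow> 'm \<Rightarrow> bool" where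
  "is_image C u I m \<longleftrightarrow> (\<exists>Q j. is_cokernel C u Q j \<and> is_kernel C j I m)"

definition is_coimage :: "('o, 'm) precategory \<Rightarrow> 'm \<Rightarrow> 'o \<Rightarrow> 'm \<Rightarrow> bool" where
  "is_coimage C u Q p \<longleftrightarrow> (\<exists>K i. is_kernel C u K i \<and> is_cokernel C i Q p)"

text \<open>
  \<open>induced C u w\<close> says that \<open>w\<close> is the canonical morphism from the coimage to the image of \<open>u\<close>,
  for some choice of these two. For each choice it exists and is unique, see
  \<open>induced_exists_unique\<close> below.
\<close>

definition induced :: "('o, 'm) precategory \<Rightarrow> 'm \<Rightarrow> 'm \<Rightarrow> bool" where
  "induced C u w \<longleftrightarrow> (\<exists>Q p I m. is_coimage C u Q p \<and> is_image C u I m \<and>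
     w \<in> Hom C Q I \<and> u = m \<cdot>\<^bsub>C\<^esub> (w \<cdot>\<^bsub>C\<^esub> p))"

definition strict :: "('o, 'm) precategory \<Rightarrow> 'm \<Rightarrow> bool" where
  "strict C u \<longleftrightarrow> (\<exists>w. induced C u w \<and> isomorphism C w)"

locale semiabelian_category = preadditive_category +
  assumes kernel_exists: "u \<in> Mor C \<Longrightarrow> \<exists>K i. is_kernel C u K i"
    and cokernel_exists: "u \<in> Mor C \<Longrightarrow> \<exists>Q j. is_cokernel C u Q j"
    and finite_products:
      "(\<And>k. k < n \<Longrightarrow> X k \<in> Obj C) \<Longrightarrow> \<exists>P p. is_product C n X P p"
    and induced_bijective: "induced C u w \<Longrightarrow> bijective C w"

definition subobject :: "('o, 'm) precategory \<Rightarrow> 'o \<Rightarrow> 'o \<Rightarrow> 'm \<Rightarrow> bool" where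
  "subobject C A A' i \<longleftrightarrow> i \<in> Hom C A' A \<and> injective C i"

definition strict_subobject :: "('o, 'm) precategory \<Rightarrow> 'o \<Rightarrow> 'o \<Rightarrow> 'm \<Rightarrow> bool" where
  "strict_subobject C A A' i \<longleftrightarrow> subobject C A A' i \<and> strict C i"

context category
begin

lemma HomD: "f \<in> Hom C A B \<Longrightarrow> f \<in> Mor C \<and> Src C f = A \<and> Tgt C f = B \<and> A \<in> Obj C \<and> B \<in> Obj C"
  using Src_Obj Tgt_Obj by (auto simp: Hom_def)

end

context preadditive_category
begin

lemma Zero_Hom: "\<lbrakk>A \<in> Obj C; B \<in> Obj C\<rbrakk> \<Longrightarrow> Zero C A B \<in> Hom C A B"
  using comm_group_Hom[of A B] monoid.one_closed[of "Hom_group C A B"]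
  by (simp add: Hom_group_def comm_group_def group_def)

lemma Plus_idem_Zero:
  assumes "f \<in> Hom C A B" "Plus C f f = f"
  shows "f = Zero C A B"
proof -
  have "group (Hom_group C A B)"
    using comm_group_Hom[of A B] HomD[OF assms(1)] by (simp add: comm_group_def)
  from group.l_cancel_one'[OF this, of f f] assms show ?thesis
    by (simp add: Hom_group_def)
qed

lemma Zero_Plus_Zero:
  "\<lbrakk>A \<in> Obj C; B \<in> Obj C\<rbrakk> \<Longrightarrow> Plus C (Zero C A B) (Zero C A B) = Zero C A B"
  using comm_group_Hom[of A B] monoid.l_one[of "Hom_group C A B" "Zero C A B"] Zero_Hom[of A B]
  by (simp add: Hom_group_def comm_group_def group_def)

lemma Zero_Comp:
  assumes "f \<in> Hom C A B" "D \<in> Obj C"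
  shows "Zero C B D \<cdot> f = Zero C A D"
proof -
  have B: "B \<in> Obj C" using HomD[OF assms(1)] by simp
  note z = Zero_Hom[OF B assms(2)]
  have "Plus C (Zero C B D \<cdot> f) (Zero C B D \<cdot> f) = Zero C B D \<cdot> f"
    using Plus_Comp[OF assms(1) z z] Zero_Plus_Zero[OF B assms(2)] by simp
  then show ?thesis using Plus_idem_Zero[OF Comp_Hom[OF assms(1) z]] by simp
qed

lemma Comp_Zero:
  assumes "g \<in> Hom C B D" "A \<in> Obj C"
  shows "g \<cdot> Zero C A B = Zero C A D"
proof -
  have B: "B \<in> Obj C" using HomD[OF assms(1)] by simp
  note z = Zero_Hom[OF assms(2) B]
  have "Plus C (g \<cdot> Zero C A B) (g \<cdot> Zero C A B) = g \<cdot> Zero C A B"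
    using Comp_Plus[OF z z assms(1)] Zero_Plus_Zero[OF assms(2) B] by simp
  then show ?thesis using Plus_idem_Zero[OF Comp_Hom[OF z assms(1)]] by simp
qed

lemma kernel_cancel:
  assumes k: "is_kernel C u K i" and g: "g \<in> Hom C T K" and h: "h \<in> Hom C T K"
    and eq: "i \<cdot> g = i \<cdot> h"
  shows "g = h"
proof -
  have i: "i \<in> Hom C K (Src C u)" and u: "u \<in> Hom C (Src C u) (Tgt C u)"
    and ui: "u \<cdot> i = Zero C K (Tgt C u)"
    using k by (auto simp: is_kernel_def Hom_def)
  have "u \<cdot> (i \<cdot> g) = Zero C T (Tgt C u)"
    using Comp_assoc[OF g i u] ui Zero_Comp[OF g] HomD[OF u] by simp
  then have "\<exists>!g'. g' \<in> Hom C T K \<and> i \<cdot> g' = i \<cdot> g"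
    using k Comp_Hom[OF g i] HomD[OF g] by (auto simp: is_kernel_def)
  with g h eq show ?thesis by metis
qed

lemma cokernel_cancel:
  assumes k: "is_cokernel C u Q j" and g: "g \<in> Hom C Q T" and h: "h \<in> Hom C Q T"
    and eq: "g \<cdot> j = h \<cdot> j"
  shows "g = h"
proof -
  have j: "j \<in> Hom C (Tgt C u) Q" and u: "u \<in> Hom C (Src C u) (Tgt C u)"
    and ju: "j \<cdot> u = Zero C (Src C u) Q"
    using k by (auto simp: is_cokernel_def Hom_def)
  have "(g \<cdot> j) \<cdot> u = Zero C (Src C u) T"
    using Comp_assoc[OF u j g] ju Comp_Zero[OF g] HomD[OF u] by simp
  then have "\<exists>!g'. g' \<in> Hom C Q T \<and> g' \<cdot> j = g \<cdot> j"
    using k Comp_Hom[OF j g] HomD[OF g] by (auto simp: is_cokernel_def)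
  with g h eq show ?thesis by metis
qed

lemma induced_exists_unique:
  assumes "is_coimage C u Q p" "is_image C u I m"
  shows "\<exists>!w. w \<in> Hom C Q I \<and> u = m \<cdot> (w \<cdot> p)"
proof -
  obtain K i where k: "is_kernel C u K i" and q: "is_cokernel C i Q p"
    using assms(1) by (auto simp: is_coimage_def)
  obtain R j where r: "is_cokernel C u R j" and im: "is_kernel C j I m"
    using assms(2) by (auto simp: is_image_def)
  define A B where "A = Src C u" and "B = Tgt C u"
  have u: "u \<in> Hom C A B" and i: "i \<in> Hom C K A" and ui: "u \<cdot> i = Zero C K B"
    using k by (auto simp: is_kernel_def Hom_def A_def B_def)
  have p: "p \<in> Hom C A Q" using q HomD[OF i] by (auto simp: is_cokernel_def)
  have j: "j \<in> Hom C B R" and ju: "j \<cdot> u = Zero C A R"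
    using r by (auto simp: is_cokernel_def A_def B_def)
  have m: "m \<in> Hom C I B" using im HomD[OF j] by (auto simp: is_kernel_def)
  obtain u' where u': "u' \<in> Hom C Q B" "u' \<cdot> p = u"
    using q u ui HomD[OF u] HomD[OF i] unfolding is_cokernel_def by metis
  have "(j \<cdot> u') \<cdot> p = Zero C Q R \<cdot> p"
    using Comp_assoc[OF p u'(1) j] u'(2) ju Zero_Comp[OF p] HomD[OF j] by simp
  then have "j \<cdot> u' = Zero C Q R"
    using cokernel_cancel[OF q Comp_Hom[OF u'(1) j] Zero_Hom] HomD[OF p] HomD[OF j] by simp
  then obtain w where w: "w \<in> Hom C Q I" "m \<cdot> w = u'"
    using im u'(1) HomD[OF u'(1)] HomD[OF j] unfolding is_kernel_def by metis
  show ?thesis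
  proof (rule ex1I[of _ w])
    show "w \<in> Hom C Q I \<and> u = m \<cdot> (w \<cdot> p)"
      using w u' Comp_assoc[OF p w(1) m] by simp
  next
    fix w' assume w': "w' \<in> Hom C Q I \<and> u = m \<cdot> (w' \<cdot> p)"
    then have "m \<cdot> (w' \<cdot> p) = m \<cdot> (w \<cdot> p)"
      using w u' Comp_assoc[OF p w(1) m] by simp
    then have "w' \<cdot> p = w \<cdot> p"
      using kernel_cancel[OF im] Comp_Hom[OF p] w w' by blast
    then show "w' = w" using cokernel_cancel[OF q] w w' by blast
  qed
qed

end

end

theory Submission
  imports Defs
begin

text \<open>
  Everything follows from looking at the composite \<open>u = j' \<cdot> i''\<close>, which goes from \<open>A''\<close> to
  \<open>A/A'\<close>. Its cokernel is \<open>v\<close>, because an arrow on \<open>A/A'\<close> that kills \<open>u\<close> becomes, after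
  composition with \<open>j'\<close>, an arrow that factors through \<open>A/A''\<close> (\<open>third_iso_cokernel\<close>). Hence
  \<open>v\<close> is strict and surjective like every cokernel, it is also a cokernel of its own kernel, which
  gives the final isomorphism, and \<open>(Ker v, l)\<close> is an image of \<open>u\<close>.

  The kernel of \<open>u\<close> is \<open>(A', i)\<close> (\<open>third_iso_kernel\<close>), so the coimage of \<open>u\<close> is
  \<open>A''/A'\<close>. The arrow from \<open>A''/A'\<close> to \<open>Ker v\<close> is therefore the canonical arrow from the
  coimage of \<open>u\<close> to its image, and this is bijective by the axiom of a semiabelian category.

  That \<open>(A', i)\<close> is the kernel of \<open>u\<close> uses that \<open>i'' \<cdot> i\<close> is the kernel of its cokernel \<open>j'\<close>.
  For this the same axiom is applied to \<open>i'' \<cdot> i\<close> (\<open>kernel_comp_is_kernel\<close>).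
\<close>

section \<open>Kernels and cokernels in preadditive categories\<close>

context category
begin

lemma injectiveD:
  assumes "injective C u" "u \<in> Hom C A B" "f \<in> Hom C T A" "g \<in> Hom C T A" "u \<cdot> f = u \<cdot> g"
  shows "f = g"
  using assms HomD[OF assms(3)] by (auto simp: injective_def Hom_def)

lemma surjectiveD:
  assumes "surjective C u" "u \<in> Hom C A B" "f \<in> Hom C B T" "g \<in> Hom C B T" "f \<cdot> u = g \<cdot> u"
  shows "f = g"
  using assms HomD[OF assms(3)] by (auto simp: surjective_def Hom_def)

lemma injective_comp:
  assumes f: "f \<in> Hom C A B" "injective C f" and g: "g \<in> Hom C B D" "injective C g"
  shows "injective C (g \<cdot> f)"
proof -
  note gf = Comp_Hom[OF f(1) g(1)]
  have "a = b" if a: "a \<in> Hom C T A" and b: "b \<in> Hom C T A" and eq: "g \<cdot> f \<cdot> a = g \<cdot> f \<cdot> b" for T a b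
  proof -
    have "g \<cdot> (f \<cdot> a) = g \<cdot> (f \<cdot> b)"
      using eq Comp_assoc[OF a f(1) g(1)] Comp_assoc[OF b f(1) g(1)] by simp
    then have "f \<cdot> a = f \<cdot> b"
      by (rule injectiveD[OF g(2,1) Comp_Hom[OF a f(1)] Comp_Hom[OF b f(1)]])
    then show ?thesis by (rule injectiveD[OF f(2,1) a b])
  qed
  then show ?thesis using HomD[OF gf] by (auto simp: injective_def)
qed

lemma Ident_injective: "A \<in> Obj C \<Longrightarrow> injective C (Ident C A)"
  using HomD[OF Ident_Hom[of A]] Ident_Comp by (auto simp: injective_def)

lemma Ident_surjective: "A \<in> Obj C \<Longrightarrow> surjective C (Ident C A)"
  using HomD[OF Ident_Hom[of A]] Comp_Ident by (auto simp: surjective_def)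

lemma isomorphism_Ident: "A \<in> Obj C \<Longrightarrow> isomorphism C (Ident C A)"
  using Ident_Hom[of A] HomD[OF Ident_Hom[of A]] Comp_Ident[OF Ident_Hom[of A]]
  by (auto simp: isomorphism_def)

end

context preadditive_category
begin

lemma kernelD:
  assumes "is_kernel C u K k" "u \<in> Hom C A B"
  shows "k \<in> Hom C K A" "u \<cdot> k = Zero C K B"
  using assms by (auto simp: is_kernel_def Hom_def)

lemma kernel_factor:
  assumes "is_kernel C u K k" "u \<in> Hom C A B" "f \<in> Hom C T A" "u \<cdot> f = Zero C T B"
  obtains g where "g \<in> Hom C T K" "k \<cdot> g = f"
  using assms HomD[OF assms(3)] HomD[OF assms(2)] unfolding is_kernel_def by metis

lemma kernelI:
  assumes u: "u \<in> Hom C A B" and k: "k \<in> Hom C K A" "injective C k" and uk: "u \<cdot> k = Zero C K B"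
    and fac: "\<And>T f. \<lbrakk>f \<in> Hom C T A; u \<cdot> f = Zero C T B\<rbrakk> \<Longrightarrow> \<exists>g\<in>Hom C T K. k \<cdot> g = f"
  shows "is_kernel C u K k"
proof -
  have "\<exists>!g. g \<in> Hom C T K \<and> k \<cdot> g = f" if "f \<in> Hom C T A" "u \<cdot> f = Zero C T B" for T f
    using fac[OF that] injectiveD[OF k(2,1)] by metis
  then show ?thesis using HomD[OF u] HomD[OF k(1)] k uk by (auto simp: is_kernel_def)
qed

lemma cokernelD:
  assumes "is_cokernel C u Q j" "u \<in> Hom C A B"
  shows "j \<in> Hom C B Q" "j \<cdot> u = Zero C A Q"
  using assms by (auto simp: is_cokernel_def Hom_def)

lemma cokernel_factor:
  assumes "is_cokernel C u Q j" "u \<in> Hom C A B" "f \<in> Hom C B T" "f \<cdot> u = Zero C A T"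
  obtains g where "g \<in> Hom C Q T" "g \<cdot> j = f"
  using assms HomD[OF assms(3)] HomD[OF assms(2)] unfolding is_cokernel_def by metis

lemma cokernelI:
  assumes u: "u \<in> Hom C A B" and j: "j \<in> Hom C B Q" "surjective C j" and ju: "j \<cdot> u = Zero C A Q"
    and fac: "\<And>T f. \<lbrakk>f \<in> Hom C B T; f \<cdot> u = Zero C A T\<rbrakk> \<Longrightarrow> \<exists>g\<in>Hom C Q T. g \<cdot> j = f"
  shows "is_cokernel C u Q j"
proof -
  have "\<exists>!g. g \<in> Hom C Q T \<and> g \<cdot> j = f" if "f \<in> Hom C B T" "f \<cdot> u = Zero C A T" for T f
    using fac[OF that] surjectiveD[OF j(2,1)] by metis
  then show ?thesis using HomD[OF u] HomD[OF j(1)] j ju by (auto simp: is_cokernel_def)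
qed

lemma kernel_injective:
  assumes "is_kernel C u K k"
  shows "injective C k"
proof -
  have "k \<in> Hom C K (Src C u)" using assms by (simp add: is_kernel_def)
  then show ?thesis using HomD kernel_cancel[OF assms] by (auto simp: injective_def)
qed

lemma cokernel_surjective:
  assumes "is_cokernel C u Q j"
  shows "surjective C j"
proof -
  have "j \<in> Hom C (Tgt C u) Q" using assms by (simp add: is_cokernel_def)
  then show ?thesis using HomD cokernel_cancel[OF assms] by (auto simp: surjective_def)
qed

lemma kernel_of_injective_eq_Zero:
  assumes u: "u \<in> Hom C A B" "injective C u" and k: "is_kernel C u K k"
  shows "k = Zero C K A"
proof -
  note kD = kernelD[OF k u(1)]
  have "u \<cdot> k = u \<cdot> Zero C K A" using kD Comp_Zero[OF u(1)] HomD[OF kD(1)] by simp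
  then show ?thesis using injectiveD[OF u(2,1) kD(1)] Zero_Hom HomD[OF kD(1)] by blast
qed

lemma cokernel_of_surjective_eq_Zero:
  assumes u: "u \<in> Hom C A B" "surjective C u" and j: "is_cokernel C u Q j"
  shows "j = Zero C B Q"
proof -
  note jD = cokernelD[OF j u(1)]
  have "j \<cdot> u = Zero C B Q \<cdot> u" using jD Zero_Comp[OF u(1)] HomD[OF jD(1)] by simp
  then show ?thesis using surjectiveD[OF u(2,1) jD(1)] Zero_Hom HomD[OF jD(1)] by blast
qed

lemma Ident_is_kernel_Zero:
  assumes "A \<in> Obj C" "B \<in> Obj C"
  shows "is_kernel C (Zero C A B) A (Ident C A)"
  using assms Zero_Hom Ident_Hom Ident_injective Comp_Ident[OF Zero_Hom] Ident_Comp
  by (intro kernelI) auto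

lemma Ident_is_cokernel_Zero:
  assumes "A \<in> Obj C" "B \<in> Obj C"
  shows "is_cokernel C (Zero C A B) B (Ident C B)"
  using assms Zero_Hom Ident_Hom Ident_surjective Ident_Comp[OF Zero_Hom] Comp_Ident
  by (intro cokernelI) auto

text \<open>
  Two cokernels of the same arrow factor through each other, and both being surjective makes the
  two comparison arrows mutually inverse.
\<close>

lemma cokernels_isomorphic:
  assumes j: "is_cokernel C u Q j" and r: "is_cokernel C u R r"
  shows "isomorphic C Q R"
proof -
  have u: "u \<in> Hom C (Src C u) (Tgt C u)" using j by (auto simp: is_cokernel_def Hom_def)
  note jD = cokernelD[OF j u] and rD = cokernelD[OF r u]
  obtain f where f: "f \<in> Hom C Q R" "f \<cdot> j = r" using cokernel_factor[OF j u rD] by blast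
  obtain g where g: "g \<in> Hom C R Q" "g \<cdot> r = j" using cokernel_factor[OF r u jD] by blast
  have Q: "Q \<in> Obj C" and R: "R \<in> Obj C" using HomD[OF f(1)] by auto
  have "(g \<cdot> f) \<cdot> j = Ident C Q \<cdot> j"
    using Comp_assoc[OF jD(1) f(1) g(1)] f g Ident_Comp[OF jD(1)] by simp
  then have gf: "g \<cdot> f = Ident C Q"
    by (rule cokernel_cancel[OF j Comp_Hom[OF f(1) g(1)] Ident_Hom[OF Q]])
  have "(f \<cdot> g) \<cdot> r = Ident C R \<cdot> r"
    using Comp_assoc[OF rD(1) g(1) f(1)] f g Ident_Comp[OF rD(1)] by simp
  then have fg: "f \<cdot> g = Ident C R"
    by (rule cokernel_cancel[OF r Comp_Hom[OF g(1) f(1)] Ident_Hom[OF R]])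
  have "isomorphism C f" unfolding isomorphism_def using f(1) g(1) gf fg HomD[OF f(1)] by auto
  then show ?thesis unfolding isomorphic_def using f(1) by blast
qed

text \<open>
  The arrow \<open>u\<close> factors through the kernel \<open>k\<close> of \<open>j\<close>, so killing \<open>k\<close> is at least as strong a
  condition as killing \<open>u\<close>.
\<close>

lemma cokernel_is_cokernel_of_kernel:
  assumes j: "is_cokernel C u Q j" and k: "is_kernel C j K k"
  shows "is_cokernel C k Q j"
proof -
  have u: "u \<in> Hom C (Src C u) (Tgt C u)" using j by (auto simp: is_cokernel_def Hom_def)
  note jD = cokernelD[OF j u]
  note kD = kernelD[OF k jD(1)]
  obtain t where t: "t \<in> Hom C (Src C u) K" "k \<cdot> t = u"
    using kernel_factor[OF k jD(1) u jD(2)] by blast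
  show ?thesis
  proof (rule cokernelI[OF kD(1) jD(1) cokernel_surjective[OF j] kD(2)])
    fix T f assume f: "f \<in> Hom C (Tgt C u) T" "f \<cdot> k = Zero C K T"
    have "f \<cdot> u = Zero C (Src C u) T"
      using Comp_assoc[OF t(1) kD(1) f(1)] t f(2) Zero_Comp[OF t(1)] HomD[OF f(1)] by simp
    then show "\<exists>g\<in>Hom C Q T. g \<cdot> j = f" using cokernel_factor[OF j u f(1)] by metis
  qed
qed

text \<open>
  Strictness gives \<open>u = m \<cdot> (w \<cdot> p)\<close> with \<open>w\<close> an isomorphism, \<open>m\<close> a kernel of a cokernel of
  \<open>u\<close>, and \<open>p\<close> a cokernel of a kernel of \<open>u\<close>. The latter kernel is zero by injectivity, so
  \<open>p\<close> is invertible and \<open>u\<close> inherits the universal property of \<open>m\<close>.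
\<close>

lemma strict_injective_is_kernel:
  assumes u: "u \<in> Hom C A B" "injective C u" "strict C u" and j: "is_cokernel C u Q j"
  shows "is_kernel C j A u"
proof -
  note jD = cokernelD[OF j u(1)]
  obtain w P p I m where coim: "is_coimage C u P p" and im: "is_image C u I m"
    and w: "w \<in> Hom C P I" "u = m \<cdot> (w \<cdot> p)" "isomorphism C w"
    using u(3) unfolding strict_def induced_def by blast
  obtain K k where k: "is_kernel C u K k" and p: "is_cokernel C k P p"
    using coim unfolding is_coimage_def by blast
  obtain R r where r: "is_cokernel C u R r" and m: "is_kernel C r I m"
    using im unfolding is_image_def by blast
  note kD = kernelD[OF k u(1)] and rD = cokernelD[OF r u(1)]
  note pD = cokernelD[OF p kD(1)] and mD = kernelD[OF m rD(1)]
  have A: "A \<in> Obj C" and K: "K \<in> Obj C" using HomD[OF kD(1)] by auto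
  have k0: "k = Zero C K A" by (rule kernel_of_injective_eq_Zero[OF u(1,2) k])
  have "Ident C A \<cdot> k = Zero C K A" using k0 Ident_Comp[OF kD(1)] by simp
  then obtain s where s: "s \<in> Hom C P A" "s \<cdot> p = Ident C A"
    using cokernel_factor[OF p kD(1) Ident_Hom[OF A]] by blast
  have P: "P \<in> Obj C" and I: "I \<in> Obj C" using HomD[OF w(1)] by auto
  \<comment> \<open>A left inverse of a surjective arrow is two-sided.\<close>
  have "(p \<cdot> s) \<cdot> p = Ident C P \<cdot> p"
    using Comp_assoc[OF pD(1) s(1) pD(1)] s(2) Comp_Ident[OF pD(1)] Ident_Comp[OF pD(1)] by simp
  then have ps: "p \<cdot> s = Ident C P"
    by (rule cokernel_cancel[OF p Comp_Hom[OF s(1) pD(1)] Ident_Hom[OF P]])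
  obtain w' where w': "w' \<in> Hom C I P" "w \<cdot> w' = Ident C I"
    using w(1,3) HomD[OF w(1)] unfolding isomorphism_def by auto
  show ?thesis
  proof (rule kernelI[OF jD(1) u(1,2) jD(2)])
    fix T f assume f: "f \<in> Hom C T B" "j \<cdot> f = Zero C T Q"
    obtain y where y: "y \<in> Hom C Q R" "y \<cdot> j = r" using cokernel_factor[OF j u(1) rD] by blast
    have "r \<cdot> f = Zero C T R"
      using Comp_assoc[OF f(1) jD(1) y(1)] y(2) f(2) Comp_Zero[OF y(1)] HomD[OF f(1)] by simp
    then obtain h where h: "h \<in> Hom C T I" "m \<cdot> h = f" using kernel_factor[OF m rD(1) f(1)] by blast
    define h' where "h' = w' \<cdot> h"
    have h': "h' \<in> Hom C T P" unfolding h'_def by (rule Comp_Hom[OF h(1) w'(1)])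
    have sh': "s \<cdot> h' \<in> Hom C T A" by (rule Comp_Hom[OF h' s(1)])
    have "p \<cdot> (s \<cdot> h') = h'" using Comp_assoc[OF h' s(1) pD(1)] ps Ident_Comp[OF h'] by simp
    moreover have "w \<cdot> h' = h"
      unfolding h'_def using Comp_assoc[OF h(1) w'(1) w(1)] w'(2) Ident_Comp[OF h(1)] by simp
    ultimately have "(w \<cdot> p) \<cdot> (s \<cdot> h') = h" using Comp_assoc[OF sh' pD(1) w(1)] by simp
    then have "u \<cdot> (s \<cdot> h') = f"
      using w(2) h(2) Comp_assoc[OF sh' Comp_Hom[OF pD(1) w(1)] mD(1)] by simp
    then show "\<exists>g\<in>Hom C T A. u \<cdot> g = f" using sh' by blast
  qed
qed

end

section \<open>Strict arrows in semiabelian categories\<close>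

context semiabelian_category
begin

lemma Ident_is_coimage:
  assumes u: "u \<in> Hom C A B" "injective C u"
  shows "is_coimage C u A (Ident C A)"
proof -
  obtain K k where k: "is_kernel C u K k" using kernel_exists HomD[OF u(1)] by blast
  have "is_cokernel C (Zero C K A) A (Ident C A)"
    using Ident_is_cokernel_Zero HomD[OF kernelD(1)[OF k u(1)]] by blast
  then have "is_cokernel C k A (Ident C A)" using kernel_of_injective_eq_Zero[OF u k] by simp
  then show ?thesis using k unfolding is_coimage_def by blast
qed

lemma Ident_is_image:
  assumes u: "u \<in> Hom C A B" "surjective C u"
  shows "is_image C u B (Ident C B)"
proof -
  obtain Q j where j: "is_cokernel C u Q j" using cokernel_exists HomD[OF u(1)] by blast
  have "is_kernel C (Zero C B Q) B (Ident C B)"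
    using Ident_is_kernel_Zero HomD[OF cokernelD(1)[OF j u(1)]] by blast
  then have "is_kernel C j B (Ident C B)" using cokernel_of_surjective_eq_Zero[OF u j] by simp
  then show ?thesis using j unfolding is_image_def by blast
qed

text \<open>
  A cokernel is its own coimage, and its image is its whole target, so an identity is a canonical
  arrow between the two.
\<close>

lemma cokernel_strict:
  assumes j: "is_cokernel C u Q j"
  shows "strict C j"
proof -
  have jH: "j \<in> Hom C (Tgt C u) Q" using j by (simp add: is_cokernel_def)
  have Q: "Q \<in> Obj C" using HomD[OF jH] by simp
  obtain K k where k: "is_kernel C j K k" using kernel_exists HomD[OF jH] by blast
  have "is_coimage C j Q j"
    unfolding is_coimage_def using k cokernel_is_cokernel_of_kernel[OF j k] by blast
  moreover have "is_image C j Q (Ident C Q)"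
    by (rule Ident_is_image[OF jH cokernel_surjective[OF j]])
  moreover have "j = Ident C Q \<cdot> (Ident C Q \<cdot> j)" using Ident_Comp[OF jH] by simp
  ultimately have "induced C j (Ident C Q)" unfolding induced_def using Ident_Hom[OF Q] by blast
  then show ?thesis unfolding strict_def using isomorphism_Ident[OF Q] by blast
qed

text \<open>
  Let \<open>(K, m)\<close> be the image of \<open>b \<cdot> a\<close>, that is, the kernel of its cokernel \<open>c\<close>, and let \<open>t\<close>
  be the canonical arrow from \<open>A\<close> to \<open>K\<close>. The arrow \<open>m\<close> factors through \<open>b\<close> as \<open>b \<cdot> n\<close>, and
  \<open>n \<cdot> t = a\<close> is killed by \<open>d\<close>. Since \<open>t\<close> is surjective by the semiabelian axiom, \<open>d\<close> kills \<open>n\<close>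
  itself, so that \<open>n\<close> factors through \<open>a\<close> and \<open>m\<close> through \<open>b \<cdot> a\<close>.
\<close>

lemma kernel_comp_is_kernel:
  assumes a: "a \<in> Hom C A B" "d \<in> Hom C B E" "is_kernel C d A a"
    and b: "b \<in> Hom C B D" "e \<in> Hom C D F" "is_kernel C e B b"
    and c: "is_cokernel C (b \<cdot> a) Q c"
  shows "is_kernel C c A (b \<cdot> a)"
proof -
  note ba = Comp_Hom[OF a(1) b(1)]
  note inj_ba = injective_comp[OF a(1) kernel_injective[OF a(3)] b(1) kernel_injective[OF b(3)]]
  note aD = kernelD[OF a(3,2)] and bD = kernelD[OF b(3,2)] and cD = cokernelD[OF c ba]
  have A: "A \<in> Obj C" and E: "E \<in> Obj C" and F: "F \<in> Obj C"
    using HomD[OF a(1)] HomD[OF a(2)] HomD[OF b(2)] by auto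
  obtain K m where m: "is_kernel C c K m" using kernel_exists HomD[OF cD(1)] by blast
  note mD = kernelD[OF m cD(1)]
  have K: "K \<in> Obj C" using HomD[OF mD(1)] by simp
  obtain t where t: "t \<in> Hom C A K" "m \<cdot> t = b \<cdot> a" using kernel_factor[OF m cD(1) ba cD(2)] by blast
  have "is_image C (b \<cdot> a) K m" unfolding is_image_def using c m by blast
  then have "induced C (b \<cdot> a) t"
    unfolding induced_def using Ident_is_coimage[OF ba inj_ba] t Comp_Ident[OF t(1)] by metis
  then have t_surj: "surjective C t" using induced_bijective by (simp add: bijective_def)
  have "e \<cdot> (b \<cdot> a) = Zero C A F"
    using Comp_assoc[OF a(1) b(1,2)] bD Zero_Comp[OF a(1) F] by simp
  then obtain x where x: "x \<in> Hom C Q F" "x \<cdot> c = e" using cokernel_factor[OF c ba b(2)] by blast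
  have "e \<cdot> m = Zero C K F"
    using Comp_assoc[OF mD(1) cD(1) x(1)] x(2) mD(2) Comp_Zero[OF x(1) K] by simp
  then obtain n where n: "n \<in> Hom C K B" "b \<cdot> n = m" using kernel_factor[OF b(3,2) mD(1)] by blast
  have "b \<cdot> (n \<cdot> t) = b \<cdot> a" using Comp_assoc[OF t(1) n(1) b(1)] n t by simp
  then have nt: "n \<cdot> t = a" by (rule kernel_cancel[OF b(3) Comp_Hom[OF t(1) n(1)] a(1)])
  have "(d \<cdot> n) \<cdot> t = Zero C K E \<cdot> t"
    using Comp_assoc[OF t(1) n(1) a(2)] nt aD(2) Zero_Comp[OF t(1) E] by simp
  then have "d \<cdot> n = Zero C K E"
    by (rule surjectiveD[OF t_surj t(1) Comp_Hom[OF n(1) a(2)] Zero_Hom[OF K E]])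
  then obtain s where s: "s \<in> Hom C K A" "a \<cdot> s = n" using kernel_factor[OF a(3,2) n(1)] by blast
  have bas: "(b \<cdot> a) \<cdot> s = m" using Comp_assoc[OF s(1) a(1) b(1)] s n by simp
  show ?thesis
  proof (rule kernelI[OF cD(1) ba inj_ba cD(2)])
    fix T f assume f: "f \<in> Hom C T D" "c \<cdot> f = Zero C T Q"
    obtain h where h: "h \<in> Hom C T K" "m \<cdot> h = f" using kernel_factor[OF m cD(1) f] by blast
    have "(b \<cdot> a) \<cdot> (s \<cdot> h) = f" using Comp_assoc[OF h(1) s(1) ba] bas h(2) by simp
    then show "\<exists>g\<in>Hom C T A. (b \<cdot> a) \<cdot> g = f" using Comp_Hom[OF h(1) s(1)] by blast
  qed
qed

end

section \<open>The arrow from a subobject to a quotient\<close>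

context preadditive_category
begin

text \<open>
  If \<open>f\<close> kills \<open>c \<cdot> b\<close>, then \<open>f \<cdot> c = g \<cdot> e\<close> for some \<open>g\<close>, and cancelling \<open>c\<close> from
  \<open>f \<cdot> c = g \<cdot> (v \<cdot> c)\<close> shows that \<open>f\<close> factors through \<open>v\<close>.
\<close>

lemma third_iso_cokernel:
  assumes a: "a \<in> Hom C A B" and b: "b \<in> Hom C B D"
    and c: "is_cokernel C (b \<cdot> a) Q c" and e: "is_cokernel C b F e"
    and v: "v \<in> Hom C Q F" "e = v \<cdot> c"
  shows "is_cokernel C (c \<cdot> b) F v"
proof -
  note cD = cokernelD[OF c Comp_Hom[OF a b]] and eD = cokernelD[OF e b]
  have "surjective C v"
    unfolding surjective_def
  proof (intro conjI ballI impI)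
    show "v \<in> Mor C" using HomD[OF v(1)] by simp
    fix T g h assume "g \<in> Hom C (Tgt C v) T" "h \<in> Hom C (Tgt C v) T" and eq: "g \<cdot> v = h \<cdot> v"
    then have g: "g \<in> Hom C F T" and h: "h \<in> Hom C F T" using HomD[OF v(1)] by auto
    have "g \<cdot> e = h \<cdot> e"
      using eq v(2) Comp_assoc[OF cD(1) v(1) g] Comp_assoc[OF cD(1) v(1) h] by simp
    then show "g = h" by (rule cokernel_cancel[OF e g h])
  qed
  moreover have "v \<cdot> (c \<cdot> b) = Zero C B F" using Comp_assoc[OF b cD(1) v(1)] v(2) eD(2) by simp
  ultimately show ?thesis
  proof (rule cokernelI[OF Comp_Hom[OF b cD(1)] v(1)])
    fix T f assume f: "f \<in> Hom C Q T" "f \<cdot> (c \<cdot> b) = Zero C B T"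
    have "(f \<cdot> c) \<cdot> b = Zero C B T" using Comp_assoc[OF b cD(1) f(1)] f(2) by simp
    then obtain g where g: "g \<in> Hom C F T" "g \<cdot> e = f \<cdot> c"
      using cokernel_factor[OF e b Comp_Hom[OF cD(1) f(1)]] by blast
    have "(g \<cdot> v) \<cdot> c = f \<cdot> c" using Comp_assoc[OF cD(1) v(1) g(1)] g(2) v(2) by simp
    then have "g \<cdot> v = f" by (rule cokernel_cancel[OF c Comp_Hom[OF v(1) g(1)] f(1)])
    then show "\<exists>g\<in>Hom C F T. g \<cdot> v = f" using g(1) by blast
  qed
qed

text \<open>
  If \<open>c \<cdot> b\<close> kills \<open>f\<close>, then \<open>b \<cdot> f\<close> factors through the kernel \<open>b \<cdot> a\<close> of \<open>c\<close>, and \<open>b\<close> can be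
  cancelled.
\<close>

lemma third_iso_kernel:
  assumes a: "a \<in> Hom C A B" "injective C a" and b: "b \<in> Hom C B D" "injective C b"
    and c: "c \<in> Hom C D Q" "is_kernel C c A (b \<cdot> a)"
  shows "is_kernel C (c \<cdot> b) A a"
proof -
  have "(c \<cdot> b) \<cdot> a = Zero C A Q" using Comp_assoc[OF a(1) b(1) c(1)] kernelD[OF c(2,1)] by simp
  then show ?thesis
  proof (rule kernelI[OF Comp_Hom[OF b(1) c(1)] a])
    fix T f assume f: "f \<in> Hom C T B" "(c \<cdot> b) \<cdot> f = Zero C T Q"
    have "c \<cdot> (b \<cdot> f) = Zero C T Q" using Comp_assoc[OF f(1) b(1) c(1)] f(2) by simp
    then obtain h where h: "h \<in> Hom C T A" "(b \<cdot> a) \<cdot> h = b \<cdot> f"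
      using kernel_factor[OF c(2,1) Comp_Hom[OF f(1) b(1)]] by blast
    have "b \<cdot> (a \<cdot> h) = b \<cdot> f" using Comp_assoc[OF h(1) a(1) b(1)] h(2) by simp
    then have "a \<cdot> h = f" by (rule injectiveD[OF b(2,1) Comp_Hom[OF h(1) a(1)] f(1)])
    then show "\<exists>g\<in>Hom C T A. a \<cdot> g = f" using h(1) by blast
  qed
qed

end

section \<open>The isomorphism theorem\<close>

theorem theorem4p16:
  fixes C :: "('o, 'm) precategory" (structure)
  assumes "semiabelian_category C"
    and "A \<in> Obj C"
    and "strict_subobject C A A'' i''"
    and "strict_subobject C A'' A' i"
    and "is_cokernel C (i'' \<cdot> i) A_A' j'"
    and "is_cokernel C i'' A_A'' j''"
    and "is_cokernel C i A''_A' q"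
  shows "(\<exists>!v. v \<in> Hom C A_A' A_A'' \<and> strict C v \<and> surjective C v \<and> j'' = v \<cdot> j') \<and>
    (\<forall>v Kv l. v \<in> Hom C A_A' A_A'' \<and> strict C v \<and> surjective C v \<and> j'' = v \<cdot> j' \<and>
       is_kernel C v Kv l \<longrightarrow>
         (\<exists>w. w \<in> Hom C A''_A' Kv \<and> l \<in> Hom C Kv A_A' \<and> v \<in> Hom C A_A' A_A'' \<and>
            bijective C w) \<and>
         (\<forall>R r. is_cokernel C l R r \<longrightarrow> isomorphic C R A_A''))"
proof -
  interpret semiabelian_category C by (rule assms(1))
  have i'': "i'' \<in> Hom C A'' A" "injective C i''" "strict C i''"
    and i: "i \<in> Hom C A' A''" "injective C i" "strict C i"
    using assms(3,4) by (auto simp: strict_subobject_def subobject_def)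
  note ii = Comp_Hom[OF i(1) i''(1)]
  note j' = assms(5) and j'' = assms(6) and q = assms(7)
  note j'D = cokernelD[OF j' ii] and j''D = cokernelD[OF j'' i''(1)] and qD = cokernelD[OF q i(1)]
  note jiH = Comp_Hom[OF i''(1) j'D(1)]
  have ker_j': "is_kernel C j' A' (i'' \<cdot> i)"
    by (rule kernel_comp_is_kernel[OF i(1) qD(1) strict_injective_is_kernel[OF i q]
          i''(1) j''D(1) strict_injective_is_kernel[OF i'' j''] j'])
  have coim: "is_coimage C (j' \<cdot> i'') A''_A' q"
    unfolding is_coimage_def
    using third_iso_kernel[OF i(1,2) i''(1,2) j'D(1) ker_j'] q by blast
  have coker_v: "is_cokernel C (j' \<cdot> i'') A_A'' v" if "v \<in> Hom C A_A' A_A''" "j'' = v \<cdot> j'" for v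
    by (rule third_iso_cokernel[OF i(1) i''(1) j' j'' that])
  have "j'' \<cdot> (i'' \<cdot> i) = Zero C A' A_A''"
    using Comp_assoc[OF i(1) i''(1) j''D(1)] j''D Zero_Comp[OF i(1)] HomD[OF j''D(1)] by simp
  then obtain v where v: "v \<in> Hom C A_A' A_A''" "v \<cdot> j' = j''"
    using cokernel_factor[OF j' ii j''D(1)] by blast
  show ?thesis
  proof (intro conjI allI impI)
    show "\<exists>!v. v \<in> Hom C A_A' A_A'' \<and> strict C v \<and> surjective C v \<and> j'' = v \<cdot> j'"
    proof (rule ex1I[of _ v])
      have cv: "is_cokernel C (j' \<cdot> i'') A_A'' v" using coker_v v by simp
      show "v \<in> Hom C A_A' A_A'' \<and> strict C v \<and> surjective C v \<and> j'' = v \<cdot> j'"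
        using v cokernel_strict[OF cv] cokernel_surjective[OF cv] by simp
    next
      fix v' assume "v' \<in> Hom C A_A' A_A'' \<and> strict C v' \<and> surjective C v' \<and> j'' = v' \<cdot> j'"
      then show "v' = v" using cokernel_cancel[OF j', of v' A_A'' v] v by metis
    qed
  next
    fix v Kv l
    assume "v \<in> Hom C A_A' A_A'' \<and> strict C v \<and> surjective C v \<and> j'' = v \<cdot> j' \<and> is_kernel C v Kv l"
    then have v: "v \<in> Hom C A_A' A_A''" "j'' = v \<cdot> j'" and l: "is_kernel C v Kv l" by auto
    note cv = coker_v[OF v]
    have im: "is_image C (j' \<cdot> i'') Kv l" unfolding is_image_def using cv l by blast
    obtain w where w: "w \<in> Hom C A''_A' Kv" "j' \<cdot> i'' = l \<cdot> (w \<cdot> q)"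
      using induced_exists_unique[OF coim im] by blast
    have "induced C (j' \<cdot> i'') w" unfolding induced_def using coim im w by blast
    then have "bijective C w" by (rule induced_bijective)
    then show "\<exists>w. w \<in> Hom C A''_A' Kv \<and> l \<in> Hom C Kv A_A' \<and> v \<in> Hom C A_A' A_A'' \<and> bijective C w"
      using w(1) kernelD(1)[OF l v(1)] v(1) by blast
  next
    fix v Kv l R r
    assume asm: "v \<in> Hom C A_A' A_A'' \<and> strict C v \<and> surjective C v \<and> j'' = v \<cdot> j' \<and>
        is_kernel C v Kv l" and r: "is_cokernel C l R r"
    have "is_cokernel C l A_A'' v"
      using cokernel_is_cokernel_of_kernel[OF coker_v] asm by blast
    then show "isomorphic C R A_A''" by (rule cokernels_isomorphic[OF r])
  qed
qed

end
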